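(* Let $G$ be a connected graph of order $n$. Then $HSO(G)\geq \sqrt{2}\,n$, with equality if and only if $G\cong C_n$.
   Context: All graphs are finite, simple and connected. For a graph $G$ with edge set $E(G)$, $d_i$ denotes the degree of the vertex $v_i$, and the Hyperbolic Sombor index is $HSO(G)=\sum_{v_iv_j\in E(G)}\frac{\sqrt{d_i^2+d_j^2}}{\min\{d_i,d_j\}}$. The order of a graph is its number of vertices. $C_n$ denotes the cycle of order $n$.
   Formalization: The order n is assumed to be at least 3; for n = 1 and n = 2 the only connected graphs K_1 and K_2 have HSO equal to 0 and √2, which violates the stated bound √2·n. *)

theory Defs
  imports Complex_Main "Graph_Theory.Graph_Theory"
begin

text \<open>
  Finite simple graphs are the \<^locale>\<open>pair_graph\<close>s of the Graph Theory library: finite, loopless,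
  symmetric digraphs whose arcs are pairs of vertices. An undirected edge is represented by two
  opposite arcs, so the edge set of the graph consists of the two-element sets of endpoints.
\<close>

definition edges :: "'a pair_pre_digraph \<Rightarrow> 'a set set" where
  "edges G = (\<lambda>(u, v). {u, v}) ` parcs G"

text \<open>By symmetry the out-degree is the number of neighbours.\<close>

abbreviation degree :: "'a pair_pre_digraph \<Rightarrow> 'a \<Rightarrow> nat" where
  "degree G v \<equiv> out_degree (with_proj G) v"

text \<open>
  The sum and the minimum over the two elements of an edge avoid choosing an orientation of it;
  see \<open>HSO_term_edge\<close> below for the usual form of the summand.
\<close>

definition HSO_term :: "'a pair_pre_digraph \<Rightarrow> 'a set \<Rightarrow> real" where
  "HSO_term G e = sqrt (\<Sum>v\<in>e. (real (degree G v))\<^sup>2) / real (Min (degree G ` e))"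

definition HSO :: "'a pair_pre_digraph \<Rightarrow> real" where
  "HSO G = (\<Sum>e\<in>edges G. HSO_term G e)"

lemma HSO_term_edge:
  assumes "u \<noteq> v"
  shows "HSO_term G {u, v} =
    sqrt ((real (degree G u))\<^sup>2 + (real (degree G v))\<^sup>2) / real (min (degree G u) (degree G v))"
  using assms by (simp add: HSO_term_def)

text \<open>The cycle of order \<open>n\<close> on the vertices \<open>0, \<dots>, n - 1\<close>; meaningful for \<open>n \<ge> 3\<close> only.\<close>

definition cycle_graph :: "nat \<Rightarrow> nat pair_pre_digraph" where
  "cycle_graph n = \<lparr> pverts = {..<n},
     parcs = {(i, j). i < n \<and> j < n \<and> (j = Suc i mod n \<or> i = Suc j mod n)} \<rparr>"

lemma pair_graph_cycle_graph:
  assumes "n \<ge> 3"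
  shows "pair_graph (cycle_graph n)"
proof
  show "finite (parcs (cycle_graph n))"
    by (rule finite_subset[of _ "{..<n} \<times> {..<n}"]) (auto simp: cycle_graph_def)
  show "symmetric (with_proj (cycle_graph n))"
    by (auto simp: symmetric_def cycle_graph_def intro!: symI)
  have *: "Suc i mod n \<noteq> i" if "i < n" for i
    using assms that by (cases "Suc i = n") auto
  show "fst e \<noteq> snd e" if "e \<in> parcs (cycle_graph n)" for e
    using that *[of "fst e"] *[of "snd e"] by (auto simp: cycle_graph_def)
qed (auto simp: cycle_graph_def)

end

theory Submission
  imports Defs
begin

text \<open>
  The bound follows from a discharging argument. Give every vertex \<open>v\<close> the charge \<open>1\<close> and let it
  send \<open>1 / d\<^sub>v\<close> to each of its \<open>d\<^sub>v\<close> edges. The charges arriving at the edges then add up to the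
  order of the graph, and it suffices to compare summand by summand: with \<open>a\<close> and \<open>b\<close> the degrees at
  the ends of an edge,
  \<open>sqrt (a\<^sup>2 + b\<^sup>2) / min a b \<ge> (a + b) / (sqrt 2 * min a b) = sqrt 2 * (1 / a + 1 / b) * (max a b / 2)\<close>.
  In a connected graph of order at least three no edge joins two leaves, so \<open>max a b \<ge> 2\<close> and the last
  factor is at least \<open>1\<close> (\<open>HSO_summand_bound\<close>). Trees and graphs with cycles are covered alike.

  Both estimates are sharp at once only if \<open>a = b = 2\<close>, so equality holds exactly for the 2-regular graphs
  (\<open>HSO_bound\<close>). It remains to recognise a connected 2-regular graph as a cycle
  (\<open>two_regular_connected_iso_cycle_graph\<close>): a walk that never turns back must return first to its
  starting point, and the vertices met until then are closed under taking neighbours, hence are all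
  the vertices.
\<close>

section \<open>The estimate for one edge\<close>

text \<open>
  If \<open>x \<le> y\<close> are the two degrees, clearing the denominator \<open>x * y\<close> leaves the comparison of
  \<open>sqrt 2 * (x + y)\<close> with \<open>sqrt (x\<^sup>2 + y\<^sup>2) * y\<close>. The difference of their squares is a sum of two terms
  that are nonnegative for \<open>y \<ge> 2\<close>, one vanishing only for \<open>y = 2\<close>, the other only for \<open>x = y\<close>.
\<close>

lemma HSO_summand_bound:
  fixes a b :: nat
  assumes "a > 0" "b > 0" "max a b \<ge> 2"
  shows "sqrt 2 * (1 / a + 1 / b) \<le> sqrt ((real a)\<^sup>2 + (real b)\<^sup>2) / real (min a b)"
    and "sqrt 2 * (1 / a + 1 / b) = sqrt ((real a)\<^sup>2 + (real b)\<^sup>2) / real (min a b)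
      \<longleftrightarrow> a = 2 \<and> b = 2"
proof -
  have *: "sqrt 2 * (1 / x + 1 / y) \<le> sqrt (x\<^sup>2 + y\<^sup>2) / x \<and>
      (sqrt 2 * (1 / x + 1 / y) = sqrt (x\<^sup>2 + y\<^sup>2) / x \<longleftrightarrow> x = 2 \<and> y = 2)"
    if "0 < x" "x \<le> y" "2 \<le> y" for x y :: real
  proof -
    have gap: "(sqrt (x\<^sup>2 + y\<^sup>2) * y)\<^sup>2 - (sqrt 2 * (x + y))\<^sup>2
        = (x\<^sup>2 + y\<^sup>2) * (y\<^sup>2 - 4) + 2 * (x - y)\<^sup>2"
      by (simp add: power_mult_distrib) (simp add: power2_eq_square algebra_simps)
    have y4: "y\<^sup>2 \<ge> 4"
      using that power_mono[of 2 y 2] by simp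
    have nonneg: "(x\<^sup>2 + y\<^sup>2) * (y\<^sup>2 - 4) \<ge> 0"
      using y4 by simp
    have "(sqrt 2 * (x + y))\<^sup>2 \<le> (sqrt (x\<^sup>2 + y\<^sup>2) * y)\<^sup>2"
      using gap nonneg zero_le_power2[of "x - y"] by linarith
    then have "sqrt 2 * (x + y) \<le> sqrt (x\<^sup>2 + y\<^sup>2) * y"
      by (rule power2_le_imp_le) (use that in simp)
    moreover have "sqrt 2 * (x + y) = sqrt (x\<^sup>2 + y\<^sup>2) * y \<longleftrightarrow> x = 2 \<and> y = 2"
    proof
      assume "sqrt 2 * (x + y) = sqrt (x\<^sup>2 + y\<^sup>2) * y"
      then have 0: "(x\<^sup>2 + y\<^sup>2) * (y\<^sup>2 - 4) + 2 * (x - y)\<^sup>2 = 0"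
        using gap by simp
      have "(x - y)\<^sup>2 = 0" "(x\<^sup>2 + y\<^sup>2) * (y\<^sup>2 - 4) = 0"
        using 0 nonneg zero_le_power2[of "x - y"] by linarith+
      moreover have "x\<^sup>2 + y\<^sup>2 > 0"
        using that by (simp add: sum_power2_gt_zero_iff)
      ultimately have "x = y" "y\<^sup>2 = 2\<^sup>2"
        by auto
      then show "x = 2 \<and> y = 2"
        using that by (metis power2_eq_iff_nonneg order_trans zero_le_numeral)
    next
      assume "x = 2 \<and> y = 2"
      moreover have "sqrt (8::real) = 2 * sqrt 2"
        using real_sqrt_mult[of 4 2] by simp
      ultimately show "sqrt 2 * (x + y) = sqrt (x\<^sup>2 + y\<^sup>2) * y"
        by simp
    qed
    moreover have common_denom: "sqrt 2 * (1 / x + 1 / y) = sqrt 2 * (x + y) / (x * y)"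
        "sqrt (x\<^sup>2 + y\<^sup>2) / x = sqrt (x\<^sup>2 + y\<^sup>2) * y / (x * y)"
      using that by (simp_all add: field_simps)
    moreover have frac: "p / (x * y) \<le> q / (x * y) \<longleftrightarrow> p \<le> q" "p / (x * y) = q / (x * y) \<longleftrightarrow> p = q" for p q
      using that mult_pos_pos[of x y] by (auto simp: divide_le_cancel mult_less_0_iff)
    ultimately show ?thesis
      unfolding common_denom frac by simp
  qed
  show "sqrt 2 * (1 / a + 1 / b) \<le> sqrt ((real a)\<^sup>2 + (real b)\<^sup>2) / real (min a b)"
    and "sqrt 2 * (1 / a + 1 / b) = sqrt ((real a)\<^sup>2 + (real b)\<^sup>2) / real (min a b)
      \<longleftrightarrow> a = 2 \<and> b = 2"
    using *[of "real a" "real b"] *[of "real b" "real a"] assms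
    by (cases "a \<le> b"; auto simp: add.commute min_def max_def)+
qed

section \<open>Isomorphisms and the degrees of the cycle\<close>

lemma pair_digraph_isoI:
  assumes "pair_wf_digraph G" "inj_on f (pverts G)"
    and "pverts H = f ` pverts G" "parcs H = map_prod f f ` parcs G"
  shows "digraph_iso (with_proj G) (with_proj H)"
proof -
  interpret pair_wf_digraph G by fact
  define hom where "hom = \<lparr>iso_verts = f, iso_arcs = map_prod f f, iso_head = snd, iso_tail = fst\<rparr>"
  have "inj_on (map_prod f f) (parcs G)"
    by (rule inj_on_subset[OF map_prod_inj_on[OF assms(2,2)]]) (auto dest: wellformed')
  then have "digraph_isomorphism hom"
    using assms(2) wf_digraph by (auto simp: digraph_isomorphism_def hom_def)
  moreover have "with_proj H = app_iso hom (with_proj G)"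
    using assms(3,4) by (simp add: app_iso_def hom_def with_proj_def)
  ultimately show ?thesis
    by (auto simp: digraph_iso_def)
qed

lemma degree_cycle_graph:
  assumes "n \<ge> 3" "i < n"
  shows "degree (cycle_graph n) i = 2"
proof -
  \<comment> \<open>\<open>p\<close> is the predecessor of \<open>i\<close> on the cycle; it differs from the successor because \<open>n \<ge> 3\<close>.\<close>
  define p where "p = (if i = 0 then n - 1 else i - 1)"
  have pred: "i = Suc j mod n \<longleftrightarrow> j = p" if "j < n" for j
    using assms that by (cases "Suc j = n") (auto simp: p_def)
  have "p < n" "Suc i mod n < n" "Suc i mod n \<noteq> p"
    using assms by (cases "Suc i = n"; auto simp: p_def)+
  have "j < n \<and> (j = Suc i mod n \<or> i = Suc j mod n) \<longleftrightarrow> j = Suc i mod n \<or> j = p" for j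
    using pred[of j] \<open>p < n\<close> \<open>Suc i mod n < n\<close> by (cases "j < n") auto
  then have "{j. j < n \<and> (j = Suc i mod n \<or> i = Suc j mod n)} = {Suc i mod n, p}"
    by (simp only:) blast
  moreover have "out_arcs (with_proj (cycle_graph n)) i
      = Pair i ` {j. j < n \<and> (j = Suc i mod n \<or> i = Suc j mod n)}"
    using assms(2) by (auto simp: out_arcs_def cycle_graph_def)
  ultimately have "out_arcs (with_proj (cycle_graph n)) i = Pair i ` {Suc i mod n, p}"
    by (simp only:)
  then show ?thesis
    using \<open>Suc i mod n \<noteq> p\<close> by (simp add: out_degree_def card_image inj_on_def)
qed

section \<open>Degrees in connected graphs\<close>

context pair_graph
begin

lemma degree_eq_card_neighbours: "degree G v = card (parcs G `` {v})"
proof -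
  have "out_arcs (with_proj G) v = Pair v ` (parcs G `` {v})"
    by (auto simp: out_arcs_def)
  then show ?thesis
    by (simp add: out_degree_def card_image inj_on_def)
qed

lemma finite_neighbours: "finite (parcs G `` {v})"
  by (rule finite_subset[of _ "pverts G"]) (auto dest: wellformed')

lemma degree_pos: "(u, v) \<in> parcs G \<Longrightarrow> degree G u > 0"
  using finite_neighbours[of u] by (auto simp: degree_eq_card_neighbours card_gt_0_iff)

lemma degree_eq_card_edges: "degree G v = card {e \<in> edges G. v \<in> e}"
proof -
  have "{e \<in> edges G. v \<in> e} = (\<lambda>w. {v, w}) ` (parcs G `` {v})"
    by (auto simp: edges_def intro: arcs_symmetric)
  moreover have "inj_on (\<lambda>w. {v, w}) (parcs G `` {v})"
    by (auto simp: inj_on_def doubleton_eq_iff)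
  ultimately show ?thesis
    by (simp add: degree_eq_card_neighbours card_image)
qed

text \<open>
  The only form in which connectedness enters: the lemmas below on isolated vertices, on edges between
  leaves and on closed walks each exhibit a set of vertices that no edge leaves.
\<close>

lemma connected_closed_eq_pverts:
  assumes "Digraph_Component.connected (with_proj G)"
    and "u \<in> S" "S \<subseteq> pverts G" "\<And>v w. v \<in> S \<Longrightarrow> (v, w) \<in> parcs G \<Longrightarrow> w \<in> S"
  shows "S = pverts G"
proof
  show "pverts G \<subseteq> S"
  proof
    fix v assume "v \<in> pverts G"
    moreover have "u \<in> pverts G"
      using assms by blast
    ultimately have "u \<rightarrow>\<^sup>*\<^bsub>with_proj G\<^esub> v"
      using symmetric_connected_imp_strongly_connected[OF pair_sym_arcs assms(1)]
      by (auto simp: strongly_connected_def)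
    then show "v \<in> S"
      by (induct rule: reachable_induct) (use assms in auto)
  qed
qed (rule assms(3))

lemma connected_degree_pos:
  assumes "Digraph_Component.connected (with_proj G)" "card (pverts G) \<ge> 2" "v \<in> pverts G"
  shows "degree G v > 0"
proof (rule ccontr)
  assume "\<not> degree G v > 0"
  then have "(v, w) \<notin> parcs G" for w
    using degree_pos[of v w] by auto
  then have "{v} = pverts G"
    using assms by (intro connected_closed_eq_pverts[of v]) auto
  then show False
    using assms(2) by (metis card_1_singleton_iff not_one_le_zero numeral_2_eq_2 Suc_le_mono One_nat_def)
qed

text \<open>Two adjacent leaves would form a whole component of order two.\<close>

lemma connected_edge_max_degree:
  assumes "Digraph_Component.connected (with_proj G)" "card (pverts G) \<ge> 3" "(u, v) \<in> parcs G"
  shows "max (degree G u) (degree G v) \<ge> 2"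
proof (rule ccontr)
  assume "\<not> ?thesis"
  then have "degree G u = 1" "degree G v = 1"
    using degree_pos assms(3) arcs_symmetric[OF assms(3)] by fastforce+
  moreover have "parcs G `` {x} = {y}" if leaf: "degree G x = 1" "(x, y) \<in> parcs G" for x y
  proof -
    obtain z where "parcs G `` {x} = {z}"
      using leaf(1) unfolding degree_eq_card_neighbours by (rule card_1_singletonE)
    then show ?thesis
      using leaf(2) by (metis Image_singleton_iff singletonD)
  qed
  ultimately have "parcs G `` {u} = {v}" "parcs G `` {v} = {u}"
    using assms(3) arcs_symmetric[OF assms(3)] by blast+
  then have "{u, v} = pverts G"
    using assms wellformed'[OF assms(3)] by (intro connected_closed_eq_pverts[of u]) blast+
  then show False
    using assms(2) card_insert_le_m1[of 2 "{v}" u] by (auto simp flip: \<open>{u, v} = pverts G\<close>)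
qed

section \<open>The bound and the graphs attaining it\<close>

lemma finite_edges: "finite (edges G)"
  by (simp add: edges_def)

text \<open>
  Double counting of incidences: a vertex \<open>v\<close> contributes \<open>1 / d\<^sub>v\<close> at each of its \<open>d\<^sub>v\<close> edges, in total
  \<open>1\<close>. This fails for isolated vertices, which contribute \<open>0\<close>.
\<close>

lemma sum_edges_inverse_degree:
  assumes "\<And>v. v \<in> pverts G \<Longrightarrow> degree G v > 0"
  shows "(\<Sum>e\<in>edges G. \<Sum>v\<in>e. 1 / real (degree G v)) = card (pverts G)"
proof -
  have "(\<Sum>e\<in>edges G. \<Sum>v\<in>e. 1 / real (degree G v))
      = (\<Sum>e\<in>edges G. \<Sum>v\<in>{v \<in> pverts G. v \<in> e}. 1 / real (degree G v))"
    by (intro sum.cong refl) (auto simp: edges_def dest: wellformed')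
  also have "\<dots> = (\<Sum>v\<in>pverts G. \<Sum>e\<in>{e \<in> edges G. v \<in> e}. 1 / real (degree G v))"
    by (rule sum.swap_restrict) (simp_all add: finite_edges)
  also have "\<dots> = (\<Sum>v\<in>pverts G. 1)"
    using assms by (intro sum.cong refl) (simp flip: degree_eq_card_edges)
  finally show ?thesis
    by simp
qed

text \<open>
  Summing the estimate for one edge over all edges. The sum of the gaps is \<open>0\<close> only if every gap is, and
  since every vertex lies on an edge, this forces all degrees to be \<open>2\<close>.
\<close>

lemma HSO_bound:
  assumes "Digraph_Component.connected (with_proj G)" "card (pverts G) \<ge> 3"
  shows "sqrt 2 * card (pverts G) \<le> HSO G"
    and "HSO G = sqrt 2 * card (pverts G) \<longleftrightarrow> (\<forall>v\<in>pverts G. degree G v = 2)"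
proof -
  let ?r = "\<lambda>e. sqrt 2 * (\<Sum>v\<in>e. 1 / real (degree G v))"
  have pos: "degree G v > 0" if "v \<in> pverts G" for v
    using connected_degree_pos[OF assms(1)] assms(2) that by simp
  have sum_r: "sqrt 2 * card (pverts G) = (\<Sum>e\<in>edges G. ?r e)"
    by (simp add: sum_edges_inverse_degree[OF pos] flip: sum_distrib_left)
  have edge: "?r e \<le> HSO_term G e \<and> (?r e = HSO_term G e \<longleftrightarrow> (\<forall>v\<in>e. degree G v = 2))"
    if "e \<in> edges G" for e
  proof -
    obtain u v where uv: "e = {u, v}" "(u, v) \<in> parcs G"
      using \<open>e \<in> edges G\<close> by (auto simp: edges_def)
    have "u \<noteq> v" "u \<in> pverts G" "v \<in> pverts G"
      using uv(2) no_loops' wellformed' by blast+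
    then show ?thesis
      using HSO_summand_bound[OF pos[of u] pos[of v] connected_edge_max_degree[OF assms uv(2)]]
      by (simp add: uv(1) HSO_term_edge)
  qed
  show "sqrt 2 * card (pverts G) \<le> HSO G"
    unfolding sum_r HSO_def using edge by (intro sum_mono) blast
  have "HSO G = sqrt 2 * card (pverts G) \<longleftrightarrow> (\<Sum>e\<in>edges G. HSO_term G e - ?r e) = 0"
    by (simp only: sum_r HSO_def sum_subtractf right_minus_eq)
  also have "\<dots> \<longleftrightarrow> (\<forall>e\<in>edges G. HSO_term G e - ?r e = 0)"
    using edge by (intro sum_nonneg_eq_0_iff finite_edges) auto
  also have "\<dots> \<longleftrightarrow> (\<forall>e\<in>edges G. \<forall>v\<in>e. degree G v = 2)"
    using edge by (metis right_minus_eq)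
  also have "\<dots> \<longleftrightarrow> (\<forall>v\<in>pverts G. degree G v = 2)"
  proof
    assume *: "\<forall>e\<in>edges G. \<forall>v\<in>e. degree G v = 2"
    show "\<forall>v\<in>pverts G. degree G v = 2"
    proof
      fix v assume "v \<in> pverts G"
      then obtain e where "e \<in> edges G" "v \<in> e"
        using pos[of v] by (fastforce simp: degree_eq_card_edges card_gt_0_iff)
      then show "degree G v = 2"
        using * by blast
    qed
  qed (auto simp: edges_def dest: wellformed')
  finally show "HSO G = sqrt 2 * card (pverts G) \<longleftrightarrow> (\<forall>v\<in>pverts G. degree G v = 2)" .
qed

section \<open>Connected 2-regular graphs are cycles\<close>

text \<open>
  A walk entering a vertex of degree at least two can always leave it by another edge. The next step
  depends on the last two vertices, so the choice is made along the sequence of arcs.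
\<close>

lemma non_backtracking_walk:
  assumes "\<And>v. v \<in> pverts G \<Longrightarrow> degree G v \<ge> 2" "pverts G \<noteq> {}"
  obtains f where "\<And>k. (f k, f (Suc k)) \<in> parcs G" "\<And>k. f (Suc (Suc k)) \<noteq> f k"
proof -
  have "\<exists>g. \<forall>k. (g k \<in> parcs G) \<and> (fst (g (Suc k)) = snd (g k) \<and> snd (g (Suc k)) \<noteq> fst (g k))"
  proof (rule dependent_nat_choice)
    obtain v where "v \<in> pverts G" using assms(2) by blast
    then have "parcs G `` {v} \<noteq> {}"
      using assms(1)[of v] by (auto simp: degree_eq_card_neighbours)
    then show "\<exists>x. x \<in> parcs G" by blast
  next
    fix x :: "'a \<times> 'a" and k :: nat
    assume x: "x \<in> parcs G"
    have "\<not> parcs G `` {snd x} \<subseteq> {fst x}"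
    proof
      assume "parcs G `` {snd x} \<subseteq> {fst x}"
      from card_mono[OF _ this] show False
        using assms(1)[of "snd x"] x by (auto simp: degree_eq_card_neighbours dest: arc_snd_in_verts)
    qed
    then show "\<exists>y. y \<in> parcs G \<and> fst y = snd x \<and> snd y \<noteq> fst x"
      by force
  qed
  then obtain g where g: "\<And>k. g k \<in> parcs G" "\<And>k. fst (g (Suc k)) = snd (g k)"
      "\<And>k. snd (g (Suc k)) \<noteq> fst (g k)"
    by blast
  show thesis
  proof (rule that[of "fst \<circ> g"])
    show "((fst \<circ> g) k, (fst \<circ> g) (Suc k)) \<in> parcs G" for k
      using g(1)[of k] g(2)[of k] by simp
    show "(fst \<circ> g) (Suc (Suc k)) \<noteq> (fst \<circ> g) k" for k
      using g(2)[of "Suc k"] g(3)[of k] by simp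
  qed
qed

text \<open>
  Let \<open>m\<close> be the time of the first repetition \<open>f m = f i\<close> along a non-backtracking walk \<open>f\<close>. An interior
  vertex \<open>f i\<close> with \<open>i > 0\<close> already has its two neighbours \<open>f (i - 1)\<close> and \<open>f (i + 1)\<close>, and \<open>f (m - 1)\<close>
  would be a third one. So \<open>i = 0\<close> and \<open>f\<close> maps the cycle of order \<open>m\<close> injectively to a set containing
  all neighbours of its members.
\<close>

lemma two_regular_connected_iso_cycle_graph:
  assumes conn: "Digraph_Component.connected (with_proj G)"
    and deg: "\<And>v. v \<in> pverts G \<Longrightarrow> degree G v = 2" and "pverts G \<noteq> {}"
  shows "digraph_iso (with_proj G) (with_proj (cycle_graph (card (pverts G))))"
proof -
  obtain f where arc: "\<And>k. (f k, f (Suc k)) \<in> parcs G" and nobt: "\<And>k. f (Suc (Suc k)) \<noteq> f k"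
    using non_backtracking_walk deg assms(3) by (metis order_refl)
  have vert: "f k \<in> pverts G" for k
    using arc wellformed' by blast
  have nbs: "parcs G `` {v} = {x, y}" if "(v, x) \<in> parcs G" "(v, y) \<in> parcs G" "x \<noteq> y" for v x y
  proof -
    have "card (parcs G `` {v}) = 2"
      using deg that(1) wellformed' by (metis degree_eq_card_neighbours)
    then show ?thesis
      using that by (intro card_subset_eq[symmetric] finite_neighbours) auto
  qed
  have nb_Suc: "parcs G `` {f (Suc k)} = {f k, f (Suc (Suc k))}" for k
    using arc[of k] arc[of "Suc k"] nobt[of k] arcs_symmetric by (intro nbs) fastforce+
  \<comment> \<open>With this definition \<open>f 0, \<dots>, f (m - 1)\<close> are distinct and \<open>f m\<close> is one of them.\<close>
  define m where "m = (LEAST m. \<not> inj_on f {..m})"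
  have "\<not> inj f"
  proof
    assume "inj f"
    moreover have "finite (range f)"
      using vert by (intro finite_subset[OF _ pair_finite_verts]) auto
    ultimately show False
      using finite_imageD by blast
  qed
  then have "\<exists>m. \<not> inj_on f {..m}"
    by (metis (no_types, lifting) atMost_iff inj_on_def linear)
  then have "\<not> inj_on f {..m}"
    unfolding m_def by (rule LeastI_ex)
  have inj_less: "inj_on f {..<m}"
  proof (cases m)
    case (Suc k)
    then have "inj_on f {..k}"
      using not_less_Least[of k "\<lambda>m. \<not> inj_on f {..m}"] by (simp flip: m_def)
    then show ?thesis
      by (simp add: Suc lessThan_Suc_atMost)
  qed simp
  have inj: "i = j" if "f i = f j" "i < m" "j < m" for i j
    using inj_less that by (auto dest: inj_onD)
  have "{..m} = insert m {..<m}"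
    by auto
  with \<open>\<not> inj_on f {..m}\<close> inj_less obtain i where i: "i < m" "f i = f m"
    by auto
  \<comment> \<open>Neither a loop nor a step back: at least three steps lie between the two visits of \<open>f i\<close>.\<close>
  have loop: "f k \<noteq> f (Suc k)" for k
    using arc no_loops' by blast
  have "m \<noteq> Suc i" "m \<noteq> Suc (Suc i)"
    using i(2) loop[of i] nobt[of i] by auto
  then have m3: "m \<ge> i + 3"
    using i(1) by simp
  then obtain l where l: "m = Suc l" "l \<ge> i + 2"
    by (cases m) auto
  \<comment> \<open>\<open>f l\<close> is the last new vertex, adjacent to \<open>f m\<close>.\<close>
  have close: "f m = f 0"
  proof (cases i)
    case (Suc k)
    have "f l \<in> {f k, f (Suc (Suc k))}"
      using nb_Suc[of k] arcs_symmetric[OF arc[of l]] l i Suc by auto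
    then have "l = k \<or> l = Suc (Suc k)"
      using inj[of l k] inj[of l "Suc (Suc k)"] l m3 Suc by auto
    then show ?thesis
      using l Suc by simp
  qed (use i in simp)
  have "m \<ge> 3"
    using m3 by simp
  have nb_0: "parcs G `` {f 0} = {f l, f (Suc 0)}"
  proof (rule nbs)
    show "(f 0, f l) \<in> parcs G"
      using arcs_symmetric[OF arc[of l]] close l by simp
    show "f l \<noteq> f (Suc 0)"
      using inj[of l "Suc 0"] l \<open>m \<ge> 3\<close> by auto
  qed (rule arc)
  define C where "C = cycle_graph m"
  have step: "f (Suc k mod m) = f (Suc k)" if "k < m" for k
    using that close by (cases "Suc k = m") auto
  \<comment> \<open>\<open>f\<close> carries neighbourhoods onto neighbourhoods, which gives at once that its image is closed and
    that it identifies the arcs of both graphs.\<close>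
  have nb: "parcs G `` {f k} = f ` (parcs C `` {k})" if "k < m" for k
  proof (cases k)
    case 0
    have "parcs C `` {k} = {l, Suc 0}"
      using l \<open>m \<ge> 3\<close> 0 by (auto simp: C_def cycle_graph_def mod_Suc split: if_splits)
    then show ?thesis
      using nb_0 0 by simp
  next
    case (Suc k')
    have "parcs C `` {k} = {k', Suc k mod m}"
      using that \<open>m \<ge> 3\<close> Suc by (auto simp: C_def cycle_graph_def mod_Suc split: if_splits)
    then show ?thesis
      using nb_Suc[of k'] Suc step[OF that] by simp
  qed
  have C_less: "parcs C `` {k} \<subseteq> {..<m}" for k
    by (auto simp: C_def cycle_graph_def)
  have verts: "f ` {..<m} = pverts G"
  proof (rule connected_closed_eq_pverts[OF conn])
    show "f 0 \<in> f ` {..<m}" using \<open>m \<ge> 3\<close> by simp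
    show "f ` {..<m} \<subseteq> pverts G" using vert by auto
    fix v w assume "v \<in> f ` {..<m}" "(v, w) \<in> parcs G"
    then obtain k where "k < m" "w \<in> parcs G `` {f k}"
      by auto
    then show "w \<in> f ` {..<m}"
      using nb[of k] C_less[of k] by auto
  qed
  then have "card (pverts G) = m"
    using card_image[OF inj_less] by simp
  have "pair_wf_digraph C"
    unfolding C_def using pair_graph_cycle_graph[OF \<open>m \<ge> 3\<close>]
    by (simp add: pair_graph_def pair_digraph_def pair_fin_digraph_def)
  have "digraph_iso (with_proj C) (with_proj G)"
  proof (rule pair_digraph_isoI)
    have pC: "pverts C = {..<m}" by (simp add: C_def cycle_graph_def)
    show "inj_on f (pverts C)" "pverts G = f ` pverts C"
      using inj_less verts pC by simp_all
    show "parcs G = map_prod f f ` parcs C"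
    proof (intro set_eqI iffI)
      fix a assume a: "a \<in> parcs G"
      then obtain k where "k < m" "fst a = f k"
        using arc_fst_in_verts[OF a] by (metis verts imageE lessThan_iff)
      moreover from this have "snd a \<in> f ` (parcs C `` {k})"
        using nb[of k] a by (metis Image_singleton_iff prod.collapse)
      ultimately show "a \<in> map_prod f f ` parcs C"
        by (cases a) force
    next
      fix a assume "a \<in> map_prod f f ` parcs C"
      then obtain k j where "a = (f k, f j)" "(k, j) \<in> parcs C"
        by auto
      moreover from this have "k < m"
        by (simp add: C_def cycle_graph_def)
      ultimately show "a \<in> parcs G"
        using nb[of k] by blast
    qed
  qed fact
  moreover have "wf_digraph (with_proj C)"
    using \<open>pair_wf_digraph C\<close> by (simp add: wf_digraph_wp_iff)
  ultimately show ?thesis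
    using digraph_iso_swap \<open>card (pverts G) = m\<close> C_def by blast
qed

end

section \<open>The extremal graphs of the hyperbolic Sombor index\<close>

theorem theorem2p5:
  fixes G :: "'a pair_pre_digraph" and n :: nat
  assumes "pair_graph G"
    and "Digraph_Component.connected (with_proj G)"
    and "card (pverts G) = n"
    and "n \<ge> 3"
  shows "HSO G \<ge> sqrt 2 * real n \<and>
    (HSO G = sqrt 2 * real n \<longleftrightarrow> digraph_iso (with_proj G) (with_proj (cycle_graph n)))"
proof -
  interpret pair_graph G by fact
  have "card (pverts G) \<ge> 3"
    using assms(3,4) by simp
  note bound = HSO_bound[OF assms(2) this, unfolded assms(3)]
  have "(\<forall>v\<in>pverts G. degree G v = 2) \<longleftrightarrow> digraph_iso (with_proj G) (with_proj (cycle_graph n))"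
  proof
    assume "\<forall>v\<in>pverts G. degree G v = 2"
    moreover have "pverts G \<noteq> {}"
      using assms(3,4) by auto
    ultimately show "digraph_iso (with_proj G) (with_proj (cycle_graph n))"
      using two_regular_connected_iso_cycle_graph[OF assms(2)] assms(3) by blast
  next
    assume "digraph_iso (with_proj G) (with_proj (cycle_graph n))"
    then obtain h where h: "digraph_isomorphism h" "with_proj (cycle_graph n) = app_iso h (with_proj G)"
      by (auto simp: digraph_iso_def)
    show "\<forall>v\<in>pverts G. degree G v = 2"
    proof
      fix v assume v: "v \<in> pverts G"
      have "pverts (cycle_graph n) = iso_verts h ` pverts G"
        using arg_cong[OF h(2), of verts] by simp
      then have "iso_verts h v < n"
        using v by (auto simp: cycle_graph_def)
      then show "degree G v = 2"
        using out_degree_app_iso_eq[OF h(1), of v] degree_cycle_graph[OF assms(4)] v h(2) by simp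
    qed
  qed
  with bound show ?thesis
    by simp
qed

end
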